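(* Let $a,b,c,d$ be positive integers such that $b<a$, $d<c$, and $\gcd(a,c)$ does not divide $d-b$. Define $\phi:\mathbb{N}\to\mathbb{N}$ (where $\mathbb{N}=\{1,2,3,\dots\}$) by \[ \phi(n)=\begin{cases} c\,\frac{n-b}{a}+d & \text{if } n\equiv b \pmod a,\\ a\,\frac{n-d}{c}+b & \text{if } n\equiv d \pmod c,\\ n & \text{otherwise.}\end{cases}\] Then $\phi$ is a permutation (bijection) of the positive integers, and the series $\sum_{n=1}^\infty \frac{(-1)^{\phi(n)+1}}{\phi(n)}$ converges, with \[\sum_{n=1}^\infty\frac{(-1)^{\phi(n)+1}}{\phi(n)}=\log(2)+\log\Big(\frac{c}{a}\Big)\frac{(-1)^b+(-1)^{a+b}}{2a}+\log\Big(\frac{a}{c}\Big)\frac{(-1)^{d}+(-1)^{c+d}}{2c}.\]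
   Context: The series $\sum_{n=1}^\infty (-1)^{n+1}/n$ is the alternating harmonic series (with sum $\log 2$); the series in the claim is its rearrangement induced by $\phi$, and its sum means the limit of its partial sums $\sum_{n=1}^N (-1)^{\phi(n)+1}/\phi(n)$ as $N\to\infty$. *)

theory Defs
  imports Complex_Main "HOL-Number_Theory.Cong"
begin

text \<open>
  Positive integers are represented as \<^typ>\<open>nat\<close>, and only arguments \<open>n \<ge> 1\<close> are of interest.
  For \<open>n \<ge> 1\<close> and \<open>0 < b < a\<close>, the congruence \<open>n \<equiv> b (mod a)\<close> forces \<open>n \<ge> b\<close>, so the natural
  subtraction and the division by \<open>a\<close> are exact; likewise for \<open>c\<close> and \<open>d\<close>. The first two cases
  are mutually exclusive when \<open>gcd a c\<close> does not divide \<open>d - b\<close>, so their order is immaterial.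
\<close>

definition phi :: "nat \<Rightarrow> nat \<Rightarrow> nat \<Rightarrow> nat \<Rightarrow> nat \<Rightarrow> nat" where
  "phi a b c d n =
     (if [n = b] (mod a) then c * ((n - b) div a) + d
      else if [n = d] (mod c) then a * ((n - d) div c) + b
      else n)"

end

theory Submission imports Defs "HOL-Analysis.Harmonic_Numbers" begin

text \<open>
  The map \<open>\<phi>\<close> is an involution swapping \<open>a k + b\<close> with \<open>c k + d\<close>. Write \<open>F(K)\<close> and \<open>G(K)\<close> for the
  sums of the first \<open>K\<close> terms of the alternating harmonic series whose indices are \<open>a k + b\<close> and
  \<open>c k + d\<close>, respectively, and let \<open>p\<close> and \<open>q\<close> be the numbers of such indices up to \<open>N\<close>. The \<open>N\<close>-th
  partial sums of the rearranged and the original series differ by \<open>F(q) - F(p) + G(p) - G(q)\<close>.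
  Now \<open>F(K) - L log K\<close> converges, where \<open>L\<close> vanishes for odd \<open>a\<close> (Leibniz) and is \<open>\<plusminus>1/a\<close> for even \<open>a\<close>
  (comparison with the harmonic series), and \<open>q/p\<close> tends to \<open>a/c\<close>, so \<open>F(q) - F(p)\<close> tends to
  \<open>L log (a/c)\<close>; likewise for \<open>G\<close>.
\<close>

definition alt_term :: "nat \<Rightarrow> real" where
  "alt_term n = (-1) ^ (n + 1) / real n"

definition progression_sum :: "nat \<Rightarrow> nat \<Rightarrow> nat \<Rightarrow> real" where
  "progression_sum a b K = (\<Sum>k<K. alt_term (a * k + b))"

text \<open>For \<open>0 < b < a\<close> this counts the \<open>k\<close> with
  \<open>a * k + b \<le> N\<close>. Adding \<open>a\<close> before subtracting \<open>b\<close>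
  keeps the natural subtraction exact even when \<open>N < b\<close>.\<close>

definition progression_count :: "nat \<Rightarrow> nat \<Rightarrow> nat \<Rightarrow> nat" where
  "progression_count a b N = (N + a - b) div a"

text \<open>One formula for both parities of \<open>a\<close>: the two powers cancel when
  \<open>a\<close> is odd and coincide when \<open>a\<close> is even, which leaves
  \<open>(-1) ^ (b + 1) / a\<close>.\<close>

definition log_coeff :: "nat \<Rightarrow> nat \<Rightarrow> real" where
  "log_coeff a b = - ((-1) ^ b + (-1) ^ (a + b)) / (2 * real a)"

section \<open>The two progressions and the involution exchanging them\<close>

lemma cong_less_modulusE:
  fixes a b n :: nat
  assumes "b < a" "[n = b] (mod a)"
  obtains k where "n = a * k + b"
proof
  show "n = a * (n div a) + b"
    using assms by (metis cong_def mod_less mult_div_mod_eq)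
qed

text \<open>A common element \<open>n\<close> would make \<open>gcd a c\<close> divide both
  \<open>n - b\<close> and \<open>n - d\<close>, hence their difference \<open>d - b\<close>.
  Integers are used because these differences may be negative.\<close>

lemma progressions_disjoint:
  fixes a b c d n :: nat
  assumes "\<not> int (gcd a c) dvd (int d - int b)" "[n = b] (mod a)"
  shows "\<not> [n = d] (mod c)"
proof
  assume "[n = d] (mod c)"
  then have "int c dvd int n - int d"
    by (metis cong_iff_dvd_diff cong_int_iff)
  moreover have "int a dvd int n - int b"
    using assms(2) by (metis cong_iff_dvd_diff cong_int_iff)
  ultimately have "int (gcd a c) dvd (int n - int b) - (int n - int d)"
    by (meson dvd_diff dvd_trans gcd_dvd1 gcd_dvd2 int_dvd_int_iff)
  then show False
    using assms(1) by simp
qed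

lemma phi_first_progression:
  assumes "0 < a"
  shows "phi a b c d (a * k + b) = c * k + d"
  using assms by (simp add: phi_def cong_def)

text \<open>The first branch of \<open>phi\<close> takes precedence, so disjointness is what ensures
  that the second branch is reached here.\<close>

lemma phi_second_progression:
  assumes "0 < c" "\<not> int (gcd a c) dvd (int d - int b)"
  shows "phi a b c d (c * k + d) = a * k + b"
proof -
  have "[c * k + d = d] (mod c)"
    by (simp add: cong_def)
  moreover from this have "\<not> [c * k + d = b] (mod a)"
    using progressions_disjoint[OF assms(2)] by blast
  ultimately show ?thesis
    using assms(1) by (simp add: phi_def)
qed

lemma phi_involution:
  assumes "b < a" "d < c" "\<not> int (gcd a c) dvd (int d - int b)"
  shows "phi a b c d (phi a b c d n) = n"
proof -
  note phi_prog = phi_first_progression[of a b c d] phi_second_progression[of c a d b]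
  consider "[n = b] (mod a)" | "[n = d] (mod c)" | "\<not> [n = b] (mod a)" "\<not> [n = d] (mod c)"
    by blast
  then show ?thesis
  proof cases
    case 1
    with assms(1) obtain k where "n = a * k + b"
      by (rule cong_less_modulusE)
    with assms phi_prog show ?thesis by simp
  next
    case 2
    with assms(2) obtain k where "n = c * k + d"
      by (rule cong_less_modulusE)
    with assms phi_prog show ?thesis by simp
  next
    case 3
    then show ?thesis by (simp add: phi_def)
  qed
qed

lemma phi_pos:
  assumes "0 < b" "0 < d" "0 < n"
  shows "0 < phi a b c d n"
  using assms by (simp add: phi_def)

lemma bij_betw_phi:
  assumes "0 < b" "0 < d" "b < a" "d < c" "\<not> int (gcd a c) dvd (int d - int b)"
  shows "bij_betw (phi a b c d) {1..} {1..}"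
proof (rule bij_betw_byWitness[where f' = "phi a b c d"])
  have "phi a b c d ` {1..} \<subseteq> {1..}"
    using phi_pos[OF assms(1,2)] by (auto simp: Suc_le_eq)
  then show "phi a b c d ` {1..} \<subseteq> {1..}" "phi a b c d ` {1..} \<subseteq> {1..}"
    by blast+
qed (use assms phi_involution in auto)

section \<open>Counting progression terms and comparing partial sums\<close>

lemma progression_count_Suc:
  assumes "b < a"
  shows "progression_count a b (Suc N) =
    (if [Suc N = b] (mod a) then Suc (progression_count a b N) else progression_count a b N)"
proof -
  \<comment> \<open>Shifting by \<open>a - b\<close> turns the residue \<open>b\<close> into
    \<open>0\<close>; a quotient by \<open>a\<close> increases exactly when its numerator reaches a
    multiple of \<open>a\<close>.\<close>
  have "[Suc N = b] (mod a) \<longleftrightarrow> [Suc N + (a - b) = b + (a - b)] (mod a)"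
    by (simp only: cong_add_rcancel_nat)
  also have "\<dots> \<longleftrightarrow> Suc (N + a - b) mod a = 0"
    using assms by (simp add: cong_def Suc_diff_le)
  finally show ?thesis
    using assms by (simp add: progression_count_def div_Suc Suc_diff_le)
qed

text \<open>If \<open>Suc N = a * k + b\<close>, then the terms up to \<open>N\<close> are those
  with indices \<open>0\<close> to \<open>k - 1\<close>, so the count at \<open>N\<close> is the
  index of the next term. In the quotient, \<open>N + a - b\<close> has remainder
  \<open>a - 1\<close>.\<close>

lemma progression_count_next:
  assumes "b < a" "[Suc N = b] (mod a)"
  shows "Suc N = a * progression_count a b N + b"
proof -
  obtain k where k: "Suc N = a * k + b"
    using assms by (rule cong_less_modulusE)
  then have "N + a - b = (a - 1) + a * k"
    using assms(1) by linarith
  then have "progression_count a b N = k + (a - 1) div a"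
    using assms(1) by (simp only: progression_count_def div_mult_self2)
  then have "progression_count a b N = k"
    using assms(1) by simp
  with k show ?thesis by simp
qed

text \<open>Induction on \<open>N\<close>. When \<open>Suc N = a * k + b\<close>, the rearranged
  series gains the term at \<open>c * k + d\<close> instead of the one at \<open>a * k + b\<close>.
  Only the first count moves, from \<open>k\<close> to \<open>k + 1\<close>: this adds the former
  term through \<open>progression_sum c d\<close> and cancels the latter through
  \<open>progression_sum a b\<close>. The other progression is symmetric.\<close>

lemma phi_partial_sum:
  assumes "b < a" "d < c" "0 < b" "0 < d" "\<not> int (gcd a c) dvd (int d - int b)"
  shows "(\<Sum>n<N. alt_term (phi a b c d (Suc n))) =
    (\<Sum>n<N. alt_term (Suc n))
    + (progression_sum a b (progression_count c d N) - progression_sum a b (progression_count a b N))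
    + (progression_sum c d (progression_count a b N) - progression_sum c d (progression_count c d N))"
proof (induction N)
  \<comment> \<open>Both counts vanish at \<open>0\<close>, because \<open>0 < b\<close> and
    \<open>0 < d\<close> give \<open>a - b < a\<close> and \<open>c - d < c\<close>.\<close>
  case 0
  show ?case
    using assms by (simp add: progression_count_def progression_sum_def)
next
  case (Suc N)
  consider "[Suc N = b] (mod a)" "\<not> [Suc N = d] (mod c)"
    | "[Suc N = d] (mod c)" "\<not> [Suc N = b] (mod a)"
    | "\<not> [Suc N = b] (mod a)" "\<not> [Suc N = d] (mod c)"
    using progressions_disjoint[OF assms(5)] by blast
  then show ?case
  proof cases
    case 1
    let ?k = "progression_count a b N"
    have k: "Suc N = a * ?k + b"
      using assms(1) 1(1) by (rule progression_count_next)
    then have "phi a b c d (Suc N) = c * ?k + d"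
      using phi_first_progression assms(1) by (metis gr_implies_not0 neq0_conv)
    moreover have "alt_term (Suc N) = alt_term (a * ?k + b)"
      using k by simp
    ultimately show ?thesis
      using Suc.IH 1 assms by (simp add: progression_count_Suc progression_sum_def)
  next
    case 2
    let ?k = "progression_count c d N"
    have k: "Suc N = c * ?k + d"
      using assms(2) 2(1) by (rule progression_count_next)
    then have "phi a b c d (Suc N) = a * ?k + b"
      using phi_second_progression assms(2,5) by (metis gr_implies_not0 neq0_conv)
    moreover have "alt_term (Suc N) = alt_term (c * ?k + d)"
      using k by simp
    ultimately show ?thesis
      using Suc.IH 2 assms by (simp add: progression_count_Suc progression_sum_def)
  next
    case 3
    then have "phi a b c d (Suc N) = Suc N"
      by (simp add: phi_def)
    with Suc.IH 3 assms show ?thesis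
      by (simp add: progression_count_Suc)
  qed
qed

section \<open>Density of the progressions\<close>

lemma progression_count_asymp:
  assumes "b < a"
  shows "(\<lambda>N. real (progression_count a b N) / real N) \<longlonglongrightarrow> 1 / real a"
proof (rule tendsto_sandwich)
  \<comment> \<open>The remainder in the division by \<open>a\<close> is less than \<open>a\<close>,
    so \<open>a\<close> times the count stays within bounded distance of \<open>N\<close>; dividing
    by \<open>a * N\<close> gives the squeeze.\<close>
  have bounds: "real N - real b \<le> real a * real (progression_count a b N)"
    "real a * real (progression_count a b N) \<le> real N + real a" for N
  proof -
    let ?m = "N + a - b"
    have "?m mod a < a"
      using assms by simp
    with mult_div_mod_eq[of a ?m] have "N \<le> a * (?m div a) + b" "a * (?m div a) \<le> N + a"
      using assms by linarith+
    then have "real N \<le> real (a * (?m div a) + b)" "real (a * (?m div a)) \<le> real (N + a)"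
      by (simp_all only: of_nat_le_iff)
    then show "real N - real b \<le> real a * real (progression_count a b N)"
      "real a * real (progression_count a b N) \<le> real N + real a"
      by (simp_all add: progression_count_def)
  qed
  show "\<forall>\<^sub>F N in sequentially.
      (1 - real b / real N) / real a \<le> real (progression_count a b N) / real N"
    using eventually_gt_at_top[of 0]
  proof eventually_elim
    case (elim N)
    have "(1 - real b / real N) / real a = (real N - real b) / (real a * real N)"
      using elim assms by (simp add: field_simps)
    moreover have "real (progression_count a b N) / real N =
        real a * real (progression_count a b N) / (real a * real N)"
      using assms by simp
    ultimately show ?case
      by (simp only: divide_right_mono[OF bounds(1)] of_nat_0_le_iff mult_nonneg_nonneg)
  qed
  show "\<forall>\<^sub>F N in sequentially.
      real (progression_count a b N) / real N \<le> (1 + real a / real N) / real a"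
    using eventually_gt_at_top[of 0]
  proof eventually_elim
    case (elim N)
    have "(1 + real a / real N) / real a = (real N + real a) / (real a * real N)"
      using elim assms by (simp add: field_simps)
    moreover have "real (progression_count a b N) / real N =
        real a * real (progression_count a b N) / (real a * real N)"
      using assms by simp
    ultimately show ?case
      by (simp only: divide_right_mono[OF bounds(2)] of_nat_0_le_iff mult_nonneg_nonneg)
  qed
  have "(\<lambda>N. (1 - real b / real N) / real a) \<longlonglongrightarrow> (1 - 0) / real a"
    by (intro tendsto_intros lim_const_over_n) (use assms in auto)
  then show "(\<lambda>N. (1 - real b / real N) / real a) \<longlonglongrightarrow> 1 / real a"
    by simp
  have "(\<lambda>N. (1 + real a / real N) / real a) \<longlonglongrightarrow> (1 + 0) / real a"
    by (intro tendsto_intros lim_const_over_n) (use assms in auto)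
  then show "(\<lambda>N. (1 + real a / real N) / real a) \<longlonglongrightarrow> 1 / real a"
    by simp
qed

lemma filterlim_progression_count:
  assumes "b < a"
  shows "filterlim (progression_count a b) at_top sequentially"
proof -
  have "filterlim (\<lambda>N. real (progression_count a b N) / real N * real N) at_top sequentially"
    by (rule filterlim_tendsto_pos_mult_at_top[OF progression_count_asymp[OF assms] _
          filterlim_real_sequentially]) (use assms in auto)
  moreover have "\<forall>\<^sub>F N in sequentially.
      real (progression_count a b N) / real N * real N = real (progression_count a b N)"
    using eventually_gt_at_top[of 0] by eventually_elim simp
  ultimately have "filterlim (\<lambda>N. real (progression_count a b N)) at_top sequentially"
    by (simp cong: filterlim_cong)
  then show ?thesis
    by (simp add: filterlim_sequentially_iff_filterlim_real)
qed

section \<open>Logarithmic growth of sums over a progression\<close>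

lemma sum_inverse_progression_convergent:
  assumes "0 < b" "b < a"
  shows "convergent (\<lambda>K. (\<Sum>k<K. 1 / real (a * k + b)) - ln (real K) / real a)"
proof -
  \<comment> \<open>Termwise comparison with the harmonic series divided by \<open>a\<close>, for
    which \<open>harm K - ln K\<close> converges to the Euler-Mascheroni constant. Using
    \<open>Suc k\<close> matches the first \<open>K\<close> terms of \<open>harm K\<close> and makes
    \<open>g k\<close> nonnegative, since \<open>b < a\<close>.\<close>
  define g where "g k = 1 / real (a * k + b) - 1 / (real a * real (Suc k))" for k
  have "summable g"
  proof (rule summable_comparison_test)
    have "norm (g k) \<le> 1 / real k ^ 2" if "1 \<le> k" for k
    proof -
      have "real (a * k + b) \<le> real (a * Suc k)"
        unfolding of_nat_le_iff using assms by simp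
      then have le: "real a * real k + real b \<le> real a * real (Suc k)"
        by (simp add: algebra_simps)
      have "0 < real a * real k" using assms that by simp
      then have "norm (g k) = 1 / (real a * real k + real b) - 1 / (real a * real (Suc k))"
        using le unfolding g_def by (simp add: frac_le)
      \<comment> \<open>Dropping \<open>b\<close> leaves a difference of consecutive reciprocals, of
        order \<open>1 / k ^ 2\<close>; this requires \<open>k \<ge> 1\<close>.\<close>
      also have "\<dots> \<le> 1 / (real a * real k) - 1 / (real a * real (Suc k))"
        using \<open>0 < real a * real k\<close> by (intro diff_right_mono frac_le) auto
      also have "\<dots> = 1 / (real a * (real k * real (Suc k)))"
        using assms that by (simp add: divide_simps)
      also have "\<dots> \<le> 1 / (1 * (real k * real k))"
        using assms that by (intro frac_le mult_mono) auto
      finally show ?thesis by (simp add: power2_eq_square)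
    qed
    then show "\<exists>N. \<forall>k\<ge>N. norm (g k) \<le> 1 / real k ^ 2"
      by blast
    show "summable (\<lambda>k. 1 / real k ^ 2)"
      using inverse_power_summable[of 2, where 'a = real] by (simp add: field_simps)
  qed
  then have "convergent (\<lambda>K. (\<Sum>k<K. g k))"
    by (simp add: summable_iff_convergent)
  moreover have "convergent (\<lambda>K. (harm K - ln (real K)) / real a)"
    using euler_mascheroni_LIMSEQ assms
    by (auto intro!: convergentI tendsto_divide)
  ultimately have "convergent (\<lambda>K. (\<Sum>k<K. g k) + (harm K - ln (real K)) / real a)"
    by (rule convergent_add)
  moreover have "(\<Sum>k<K. g k) + (harm K - ln (real K)) / real a =
      (\<Sum>k<K. 1 / real (a * k + b)) - ln (real K) / real a" for K
  proof -
    have "harm K / real a = (\<Sum>k<K. 1 / (real a * real (Suc k)))"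
      unfolding harm_def One_nat_def sum.atLeast1_atMost_eq sum_divide_distrib
      by (intro sum.cong refl) (simp add: inverse_eq_divide mult.commute)
    then show ?thesis
      by (simp add: g_def sum_subtractf diff_divide_distrib)
  qed
  ultimately show ?thesis
    by simp
qed

lemma alternating_progression_summable:
  assumes "0 < b" "0 < a"
  shows "summable (\<lambda>k. (-1) ^ k / real (a * k + b))"
proof -
  have "summable (\<lambda>k. (-1) ^ k * (1 / real (a * k + b)))"
  proof (rule summable_Leibniz')
    have "filterlim (\<lambda>k. a * k + b) at_top sequentially"
      by (rule filterlim_at_top_mono[OF filterlim_ident])
        (use assms in \<open>auto intro!: always_eventually trans_le_add1\<close>)
    then show "(\<lambda>k. 1 / real (a * k + b)) \<longlonglongrightarrow> 0"
      by (rule filterlim_compose[OF lim_1_over_n])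
    show "1 / real (a * Suc k + b) \<le> 1 / real (a * k + b)" for k
      using assms by (intro frac_le) (auto simp: add_nonneg_pos)
  qed (use assms in auto)
  then show ?thesis by simp
qed

text \<open>For even \<open>a\<close> all indices \<open>a * k + b\<close> have the parity of
  \<open>b\<close>, so the sum is a signed sum of reciprocals growing like a logarithm. For odd
  \<open>a\<close> the signs alternate with \<open>k\<close>, the Leibniz criterion applies, and
  \<open>log_coeff a b\<close> is \<open>0\<close>.\<close>

lemma progression_sum_convergent:
  assumes "0 < b" "b < a"
  shows "convergent (\<lambda>K. progression_sum a b K - log_coeff a b * ln (real K))"
proof (cases "even a")
  case True
  have "progression_sum a b K - log_coeff a b * ln (real K) =
      (-1) ^ (b + 1) * ((\<Sum>k<K. 1 / real (a * k + b)) - ln (real K) / real a)" for K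
    using True by (simp add: progression_sum_def alt_term_def log_coeff_def power_add power_mult
        sum_distrib_left right_diff_distrib sum_negf)
  then show ?thesis
    using convergent_mult[OF convergent_const sum_inverse_progression_convergent[OF assms]]
    by presburger
next
  case False
  then have "(-1) ^ (k * a) = ((-1) ^ k :: real)" for k
    by (simp add: minus_one_power_iff)
  then have "progression_sum a b K - log_coeff a b * ln (real K) =
      (-1) ^ (b + 1) * (\<Sum>k<K. (-1) ^ k / real (a * k + b))" for K
    using False by (simp add: progression_sum_def alt_term_def log_coeff_def power_add
        sum_distrib_left mult_ac)
  moreover have conv: "convergent (\<lambda>K. \<Sum>k<K. (-1) ^ k / real (a * k + b))"
    using alternating_progression_summable[of b a] assms by (simp add: summable_iff_convergent)
  ultimately show ?thesis
    using convergent_mult[OF convergent_const conv] by presburger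
qed

text \<open>With the logarithm removed, the sums at \<open>p N\<close> and \<open>q N\<close> share
  one limit, so their difference vanishes. What remains is \<open>log_coeff a b\<close> times
  \<open>ln (q N / p N)\<close>, and this quotient tends to \<open>y / x\<close>.\<close>

lemma progression_sum_diff_tendsto:
  fixes p q :: "nat \<Rightarrow> nat" and x y :: real
  assumes "0 < b" "b < a"
    and "filterlim p at_top sequentially" "filterlim q at_top sequentially"
    and "(\<lambda>N. real (p N) / real N) \<longlonglongrightarrow> x" "(\<lambda>N. real (q N) / real N) \<longlonglongrightarrow> y"
    and "0 < x" "0 < y"
  shows "(\<lambda>N. progression_sum a b (q N) - progression_sum a b (p N))
    \<longlonglongrightarrow> log_coeff a b * ln (y / x)"
proof -
  define h where "h K = progression_sum a b K - log_coeff a b * ln (real K)" for K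
  obtain l where "h \<longlonglongrightarrow> l"
    using progression_sum_convergent[OF assms(1,2)] 
    unfolding h_def[symmetric] convergent_def by blast
  then have h: "(\<lambda>N. h (p N)) \<longlonglongrightarrow> l" "(\<lambda>N. h (q N)) \<longlonglongrightarrow> l"
    using assms(3,4) by (auto intro: filterlim_compose)
  have "(\<lambda>N. (h (q N) - h (p N)) +
      log_coeff a b * ln ((real (q N) / real N) / (real (p N) / real N)))
    \<longlonglongrightarrow> (l - l) + log_coeff a b * ln (y / x)"
    by (intro tendsto_intros h assms) (use assms in auto)
  \<comment> \<open>The identity holds only eventually: splitting the logarithm of the quotient
    requires \<open>N\<close>, \<open>p N\<close> and \<open>q N\<close> to be positive.\<close>
  moreover have "\<forall>\<^sub>F N in sequentially. (h (q N) - h (p N)) +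
      log_coeff a b * ln ((real (q N) / real N) / (real (p N) / real N)) =
      progression_sum a b (q N) - progression_sum a b (p N)"
  proof -
    have "\<forall>\<^sub>F N in sequentially. 0 < p N" "\<forall>\<^sub>F N in sequentially. 0 < q N"
      using assms(3,4) by (auto intro: eventually_compose_filterlim[OF eventually_gt_at_top])
    then show ?thesis
      using eventually_gt_at_top[of 0]
      by eventually_elim (simp add: h_def ln_div algebra_simps)
  qed
  ultimately have "(\<lambda>N. progression_sum a b (q N) - progression_sum a b (p N))
    \<longlonglongrightarrow> (l - l) + log_coeff a b * ln (y / x)"
    by (rule Lim_transform_eventually)
  then show ?thesis
    by simp
qed

section \<open>Bijectivity and the sum of the rearranged series\<close>

theorem theorem1:
  fixes a b c d :: nat
  assumes "a > 0" and "b > 0" and "c > 0" and "d > 0"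
    and "b < a" and "d < c"
    and "\<not> int (gcd a c) dvd (int d - int b)"
  shows "bij_betw (phi a b c d) {1..} {1..} \<and>
    (\<lambda>n. (-1) ^ (phi a b c d (Suc n) + 1) / real (phi a b c d (Suc n))) sums
      (ln 2
        + ln (real c / real a) * (((-1) ^ b + (-1) ^ (a + b)) / (2 * real a))
        + ln (real a / real c) * (((-1) ^ d + (-1) ^ (c + d)) / (2 * real c)))"
proof
  show "bij_betw (phi a b c d) {1..} {1..}"
    using assms by (intro bij_betw_phi)
  let ?p = "progression_count a b" and ?q = "progression_count c d"
  note count = progression_count_asymp[OF \<open>b < a\<close>] progression_count_asymp[OF \<open>d < c\<close>]
    filterlim_progression_count[OF \<open>b < a\<close>] filterlim_progression_count[OF \<open>d < c\<close>]
  have "(\<lambda>n. alt_term (Suc n)) sums ln 2"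
    using alternating_harmonic_series_sums by (simp add: alt_term_def)
  then have "(\<lambda>N. \<Sum>n<N. alt_term (Suc n)) \<longlonglongrightarrow> ln 2"
    by (simp add: sums_def)
  moreover have "(\<lambda>N. progression_sum a b (?q N) - progression_sum a b (?p N))
      \<longlonglongrightarrow> log_coeff a b * ln ((1 / real c) / (1 / real a))"
    by (rule progression_sum_diff_tendsto) (use assms count in auto)
  moreover have "(\<lambda>N. progression_sum c d (?p N) - progression_sum c d (?q N))
      \<longlonglongrightarrow> log_coeff c d * ln ((1 / real a) / (1 / real c))"
    by (rule progression_sum_diff_tendsto) (use assms count in auto)
  ultimately have "(\<lambda>N. \<Sum>n<N. alt_term (phi a b c d (Suc n))) \<longlonglongrightarrow>
      ln 2 + log_coeff a b * ln ((1 / real c) / (1 / real a))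
        + log_coeff c d * ln ((1 / real a) / (1 / real c))"
    unfolding phi_partial_sum[OF assms(5,6,2,4,7)] by (intro tendsto_add)
  \<comment> \<open>The minus sign in \<open>log_coeff\<close> is absorbed by inverting the argument
    of the logarithm: \<open>ln (a / c) = - ln (c / a)\<close>.\<close>
  also have "ln 2 + log_coeff a b * ln ((1 / real c) / (1 / real a))
        + log_coeff c d * ln ((1 / real a) / (1 / real c)) =
      ln 2 + ln (real c / real a) * (((-1) ^ b + (-1) ^ (a + b)) / (2 * real a))
        + ln (real a / real c) * (((-1) ^ d + (-1) ^ (c + d)) / (2 * real c))"
    using assms by (simp add: log_coeff_def ln_div field_simps)
  finally show "(\<lambda>n. (-1) ^ (phi a b c d (Suc n) + 1) / real (phi a b c d (Suc n))) sums
      (ln 2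
        + ln (real c / real a) * (((-1) ^ b + (-1) ^ (a + b)) / (2 * real a))
        + ln (real a / real c) * (((-1) ^ d + (-1) ^ (c + d)) / (2 * real c)))"
    by (simp add: sums_def alt_term_def)
qed

end
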